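(* Let $\overline{(\cdot)}$ be the CGPS translation from $\lambda H\mathbf{J}^{\mathbf{mse}}$ to $\underline{\lambda}H$ (and, by restriction, from $\lambda\omega\mathbf{J}^{\mathbf{mse}}$ to $\underline{\lambda}\omega$) described in the context. If $t\rightarrow u$ in $\lambda H\mathbf{J}^{\mathbf{mse}}$ (resp. $\lambda\omega\mathbf{J}^{\mathbf{mse}}$), then $\overline{t}\rightarrow^+\overline{u}$ in $\underline{\lambda}H$ (resp. $\underline{\lambda}\omega$).
   Context: Domains $\mathcal{D},\mathcal{E}::=PROP\mid\mathsf{X}\mid\mathcal{D}\to\mathcal{E}$ ($\mathsf{X}$ domain variables). Inhabitants $A,B::=X\mid\leftthreetimes X.A\mid AB\mid A\supset B\mid\forall X:\mathcal{D}.A$, with reduction $(\beta_0)\ (\leftthreetimes X.A)B\rightarrow[B/X]A$ (in any subexpression). In $\lambda\omega\mathbf{J}^{\mathbf{mse}}$ and $\underline{\lambda}\omega$ domain variables $\mathsf{X}$ are not allowed; otherwise these systems coincide with $\lambda H\mathbf{J}^{\mathbf{mse}}$ and $\underline{\lambda}H$ respectively. $\lambda H\mathbf{J}^{\mathbf{mse}}$ proof expressions: terms $t,u::=x\mid\lambda x.t\mid\Lambda X.t\mid\{c\}$; co-terms $l::=[]\mid u::l\mid B::l\mid(x)c$; commands $c::=t\,l$. Evaluation contexts $E::=[]\mid u::l\mid B::l$; for $U$ a term or inhabitant, $[]@l'=l'$, $(U::l)@l'=U::(l@l')$, $((x)t\,l)@l'=(x)t(l@l')$. Reduction: closure under all constructors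 of $(\beta_1)\ (\lambda x.t)(u::l)\rightarrow u((x)t\,l)$; $(\beta_2)\ (\Lambda X.t)(B::l)\rightarrow([B/X]t)\,l$; $(\pi)\ \{t\,l\}E\rightarrow t(l@E)$; $(\sigma)\ t(x)c\rightarrow[t/x]c$; $(\mu)\ (x)x\,l\rightarrow l$ if $x\notin l$; $(\epsilon)\ \{t[]\}\rightarrow t$; plus $B::l\rightarrow B'::l$ whenever $B\rightarrow_{\beta_0}B'$. $\underline{\lambda}H$ proof terms $t::=x\mid\lambda x.t\mid tu\mid\Lambda X.t\mid tA$, with reduction the compatible closure of $(\lambda x.t)u\rightarrow[u/x]t$, $(\Lambda X.t)B\rightarrow[B/X]t$, and $tB\rightarrow tB'$ whenever $B\rightarrow_{\beta_0}B'$; $\rightarrow^+$ denotes one or more such steps. Translation: $\bot$ fixed propositional variable, $\neg A=A\supset\bot$, $\top$ a fixed proposition and $\mathsf{s}$ a closed proof term of $\top\supset\top$ with $\mathsf{s}\,G\rightarrow^+G$ for all $G$ (e.g. $\lambda z.z$), $G^+=\mathsf{s}G$, $[t;u]=(\lambda y.t)u$ with $y\notin t$. Inhabitants: $X^*=X$, $(A\supset B)^*=\neg\overline{B}\supset\neg\overline{A}$, $(\forall X:\mathcal{D}.A)^*=\forall X:\mathcal{D}.\overline{A}$, $(\leftthreetimes X.A)^*=\leftthreetimes X.A^*$, $(AB)^*=A^*B^*$, $\overline{A}=\top\supset\neg\neg A^*$. Proof expressions ($w,m$ fresh): $(x:G,K)=x\,G^+K$; $(\lambda x.t:G,K)=[K(\lambda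 wx.w\,\overline{t});G]$; $(\Lambda X.t:G,K)=[K(\Lambda X.\overline{t});G]$; $(\{c\}:G,K)=(c:G^+,K)$; $([]:G,K)=\lambda w.wGK$; $(u::l:G,K)=\lambda w.wG(\lambda m.m\,(l:G,K)\,\overline{u})$; $(B::l:G,K)=\lambda w.wG(\lambda m.(l:G,K)(mB^* ))$; $((x)c:G,K)=\lambda x.(c:G,K)$; $(t[]:G,K)=(t:G,K)$; $(t(u::l):G,K)=(t:G,\lambda m.m\,(l:G,K)\,\overline{u})$; $(t(B::l):G,K)=(t:G,\lambda m.(l:G,K)(mB^* ))$; $(t(x)c:G,K)=((x)c:G,K)\,\overline{t}$; $\overline{t}=\lambda gk.(t:g,k)$ with $g,k$ fresh. *)

theory Defs
  imports Main
begin

text \<open>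
  All binders are de Bruijn indices.  Inhabitant variables \<open>X\<close> and proof variables \<open>x\<close> are indexed
  separately: \<open>\<Lambda>X\<close>, \<open>\<leftthreetimes>X\<close> and \<open>\<forall>X\<close> bind inhabitant index \<open>0\<close>, while \<open>\<lambda>x\<close> and the selection \<open>(x)c\<close>
  bind proof index \<open>0\<close>.  Domain variables are never bound; they are named by elements of \<open>'v\<close>.
  In every \<open>lift\<close> and \<open>subst\<close> function below, the first argument is the cutoff, respectively the
  index of the variable substituted for; the indices above that variable are decremented.
  The prefix \<open>i\<close> marks lifting and substitution for inhabitant variables.
\<close>

subsection \<open>Domains and inhabitants\<close>

datatype (dvars_dom: 'v) dom =
    PROP_dom
  | DVar 'v
  | DArr "'v dom" "'v dom"

datatype (dvars_inh: 'v) inh =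
    IVar nat
  | ILam "'v inh"
  | IApp "'v inh" "'v inh"
  | Imp "'v inh" "'v inh"
  | All "'v dom" "'v inh"

primrec ilift_inh :: "nat \<Rightarrow> 'v inh \<Rightarrow> 'v inh" where
  "ilift_inh k (IVar i) = IVar (if i < k then i else Suc i)"
| "ilift_inh k (ILam A) = ILam (ilift_inh (Suc k) A)"
| "ilift_inh k (IApp A B) = IApp (ilift_inh k A) (ilift_inh k B)"
| "ilift_inh k (Imp A B) = Imp (ilift_inh k A) (ilift_inh k B)"
| "ilift_inh k (All D A) = All D (ilift_inh (Suc k) A)"

primrec isubst_inh :: "nat \<Rightarrow> 'v inh \<Rightarrow> 'v inh \<Rightarrow> 'v inh" where
  "isubst_inh k C (IVar i) = (if i < k then IVar i else if i = k then C else IVar (i - 1))"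
| "isubst_inh k C (ILam A) = ILam (isubst_inh (Suc k) (ilift_inh 0 C) A)"
| "isubst_inh k C (IApp A B) = IApp (isubst_inh k C A) (isubst_inh k C B)"
| "isubst_inh k C (Imp A B) = Imp (isubst_inh k C A) (isubst_inh k C B)"
| "isubst_inh k C (All D A) = All D (isubst_inh (Suc k) (ilift_inh 0 C) A)"

inductive beta0 :: "'v inh \<Rightarrow> 'v inh \<Rightarrow> bool" where
  beta0: "beta0 (IApp (ILam A) B) (isubst_inh 0 B A)"
| ILam: "beta0 A A' \<Longrightarrow> beta0 (ILam A) (ILam A')"
| IAppL: "beta0 A A' \<Longrightarrow> beta0 (IApp A B) (IApp A' B)"
| IAppR: "beta0 B B' \<Longrightarrow> beta0 (IApp A B) (IApp A B')"
| ImpL: "beta0 A A' \<Longrightarrow> beta0 (Imp A B) (Imp A' B)"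
| ImpR: "beta0 B B' \<Longrightarrow> beta0 (Imp A B) (Imp A B')"
| All: "beta0 A A' \<Longrightarrow> beta0 (All D A) (All D A')"

subsection \<open>The source system \<open>\<lambda>HJ\<^sup>m\<^sup>s\<^sup>e\<close>\<close>

text \<open>
  \<open>Brc c\<close> is \<open>{c}\<close>, \<open>CTm u l\<close> is \<open>u :: l\<close>, \<open>CInh B l\<close> is \<open>B :: l\<close>, \<open>Sel c\<close> is \<open>(x)c\<close> and
  \<open>Cut t l\<close> is the command \<open>t l\<close>.
\<close>

datatype (dvars_tm: 'v) tm =
    Var nat
  | Lam "'v tm"
  | TLam "'v tm"
  | Brc "'v cmd"
and (dvars_cot: 'v) cot =
    CNil
  | CTm "'v tm" "'v cot"
  | CInh "'v inh" "'v cot"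
  | Sel "'v cmd"
and (dvars_cmd: 'v) cmd =
    Cut "'v tm" "'v cot"

primrec lift_tm :: "nat \<Rightarrow> 'v tm \<Rightarrow> 'v tm"
  and lift_cot :: "nat \<Rightarrow> 'v cot \<Rightarrow> 'v cot"
  and lift_cmd :: "nat \<Rightarrow> 'v cmd \<Rightarrow> 'v cmd" where
  "lift_tm k (Var i) = Var (if i < k then i else Suc i)"
| "lift_tm k (Lam t) = Lam (lift_tm (Suc k) t)"
| "lift_tm k (TLam t) = TLam (lift_tm k t)"
| "lift_tm k (Brc c) = Brc (lift_cmd k c)"
| "lift_cot k CNil = CNil"
| "lift_cot k (CTm u l) = CTm (lift_tm k u) (lift_cot k l)"
| "lift_cot k (CInh B l) = CInh B (lift_cot k l)"
| "lift_cot k (Sel c) = Sel (lift_cmd (Suc k) c)"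
| "lift_cmd k (Cut t l) = Cut (lift_tm k t) (lift_cot k l)"

primrec ilift_tm :: "nat \<Rightarrow> 'v tm \<Rightarrow> 'v tm"
  and ilift_cot :: "nat \<Rightarrow> 'v cot \<Rightarrow> 'v cot"
  and ilift_cmd :: "nat \<Rightarrow> 'v cmd \<Rightarrow> 'v cmd" where
  "ilift_tm k (Var i) = Var i"
| "ilift_tm k (Lam t) = Lam (ilift_tm k t)"
| "ilift_tm k (TLam t) = TLam (ilift_tm (Suc k) t)"
| "ilift_tm k (Brc c) = Brc (ilift_cmd k c)"
| "ilift_cot k CNil = CNil"
| "ilift_cot k (CTm u l) = CTm (ilift_tm k u) (ilift_cot k l)"
| "ilift_cot k (CInh B l) = CInh (ilift_inh k B) (ilift_cot k l)"
| "ilift_cot k (Sel c) = Sel (ilift_cmd k c)"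
| "ilift_cmd k (Cut t l) = Cut (ilift_tm k t) (ilift_cot k l)"

primrec subst_tm :: "nat \<Rightarrow> 'v tm \<Rightarrow> 'v tm \<Rightarrow> 'v tm"
  and subst_cot :: "nat \<Rightarrow> 'v tm \<Rightarrow> 'v cot \<Rightarrow> 'v cot"
  and subst_cmd :: "nat \<Rightarrow> 'v tm \<Rightarrow> 'v cmd \<Rightarrow> 'v cmd" where
  "subst_tm k v (Var i) = (if i < k then Var i else if i = k then v else Var (i - 1))"
| "subst_tm k v (Lam t) = Lam (subst_tm (Suc k) (lift_tm 0 v) t)"
| "subst_tm k v (TLam t) = TLam (subst_tm k (ilift_tm 0 v) t)"
| "subst_tm k v (Brc c) = Brc (subst_cmd k v c)"
| "subst_cot k v CNil = CNil"
| "subst_cot k v (CTm u l) = CTm (subst_tm k v u) (subst_cot k v l)"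
| "subst_cot k v (CInh B l) = CInh B (subst_cot k v l)"
| "subst_cot k v (Sel c) = Sel (subst_cmd (Suc k) (lift_tm 0 v) c)"
| "subst_cmd k v (Cut t l) = Cut (subst_tm k v t) (subst_cot k v l)"

primrec isubst_tm :: "nat \<Rightarrow> 'v inh \<Rightarrow> 'v tm \<Rightarrow> 'v tm"
  and isubst_cot :: "nat \<Rightarrow> 'v inh \<Rightarrow> 'v cot \<Rightarrow> 'v cot"
  and isubst_cmd :: "nat \<Rightarrow> 'v inh \<Rightarrow> 'v cmd \<Rightarrow> 'v cmd" where
  "isubst_tm k C (Var i) = Var i"
| "isubst_tm k C (Lam t) = Lam (isubst_tm k C t)"
| "isubst_tm k C (TLam t) = TLam (isubst_tm (Suc k) (ilift_inh 0 C) t)"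
| "isubst_tm k C (Brc c) = Brc (isubst_cmd k C c)"
| "isubst_cot k C CNil = CNil"
| "isubst_cot k C (CTm u l) = CTm (isubst_tm k C u) (isubst_cot k C l)"
| "isubst_cot k C (CInh B l) = CInh (isubst_inh k C B) (isubst_cot k C l)"
| "isubst_cot k C (Sel c) = Sel (isubst_cmd k C c)"
| "isubst_cmd k C (Cut t l) = Cut (isubst_tm k C t) (isubst_cot k C l)"

fun append_cot :: "'v cot \<Rightarrow> 'v cot \<Rightarrow> 'v cot" where
  "append_cot CNil l' = l'"
| "append_cot (CTm u l) l' = CTm u (append_cot l l')"
| "append_cot (CInh B l) l' = CInh B (append_cot l l')"
| "append_cot (Sel (Cut t l)) l' = Sel (Cut t (append_cot l (lift_cot 0 l')))"

inductive ectx :: "'v cot \<Rightarrow> bool" where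
  "ectx CNil"
| "ectx (CTm u l)"
| "ectx (CInh B l)"

inductive tm_red :: "'v tm \<Rightarrow> 'v tm \<Rightarrow> bool"
  and cot_red :: "'v cot \<Rightarrow> 'v cot \<Rightarrow> bool"
  and cmd_red :: "'v cmd \<Rightarrow> 'v cmd \<Rightarrow> bool" where
  beta1: "cmd_red (Cut (Lam t) (CTm u l)) (Cut u (Sel (Cut t (lift_cot 0 l))))"
| beta2: "cmd_red (Cut (TLam t) (CInh B l)) (Cut (isubst_tm 0 B t) l)"
| pi: "ectx E \<Longrightarrow> cmd_red (Cut (Brc (Cut t l)) E) (Cut t (append_cot l E))"
| sigma: "cmd_red (Cut t (Sel c)) (subst_cmd 0 t c)"
| mu: "cot_red (Sel (Cut (Var 0) (lift_cot 0 l))) l"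
| eps: "tm_red (Brc (Cut t CNil)) t"
| Lam: "tm_red t t' \<Longrightarrow> tm_red (Lam t) (Lam t')"
| TLam: "tm_red t t' \<Longrightarrow> tm_red (TLam t) (TLam t')"
| Brc: "cmd_red c c' \<Longrightarrow> tm_red (Brc c) (Brc c')"
| CTmL: "tm_red u u' \<Longrightarrow> cot_red (CTm u l) (CTm u' l)"
| CTmR: "cot_red l l' \<Longrightarrow> cot_red (CTm u l) (CTm u l')"
| CInhL: "beta0 B B' \<Longrightarrow> cot_red (CInh B l) (CInh B' l)"
| CInhR: "cot_red l l' \<Longrightarrow> cot_red (CInh B l) (CInh B l')"
| Sel: "cmd_red c c' \<Longrightarrow> cot_red (Sel c) (Sel c')"
| CutL: "tm_red t t' \<Longrightarrow> cmd_red (Cut t l) (Cut t' l)"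
| CutR: "cot_red l l' \<Longrightarrow> cmd_red (Cut t l) (Cut t l')"

subsection \<open>The target system \<open>\<lambda>H\<close>\<close>

datatype (dvars_lam: 'v) lam =
    LVar nat
  | LLam "'v lam"
  | LApp "'v lam" "'v lam"
  | LTLam "'v lam"
  | LTApp "'v lam" "'v inh"

primrec lift_lam :: "nat \<Rightarrow> 'v lam \<Rightarrow> 'v lam" where
  "lift_lam k (LVar i) = LVar (if i < k then i else Suc i)"
| "lift_lam k (LLam t) = LLam (lift_lam (Suc k) t)"
| "lift_lam k (LApp t u) = LApp (lift_lam k t) (lift_lam k u)"
| "lift_lam k (LTLam t) = LTLam (lift_lam k t)"
| "lift_lam k (LTApp t B) = LTApp (lift_lam k t) B"

primrec ilift_lam :: "nat \<Rightarrow> 'v lam \<Rightarrow> 'v lam" where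
  "ilift_lam k (LVar i) = LVar i"
| "ilift_lam k (LLam t) = LLam (ilift_lam k t)"
| "ilift_lam k (LApp t u) = LApp (ilift_lam k t) (ilift_lam k u)"
| "ilift_lam k (LTLam t) = LTLam (ilift_lam (Suc k) t)"
| "ilift_lam k (LTApp t B) = LTApp (ilift_lam k t) (ilift_inh k B)"

primrec subst_lam :: "nat \<Rightarrow> 'v lam \<Rightarrow> 'v lam \<Rightarrow> 'v lam" where
  "subst_lam k v (LVar i) = (if i < k then LVar i else if i = k then v else LVar (i - 1))"
| "subst_lam k v (LLam t) = LLam (subst_lam (Suc k) (lift_lam 0 v) t)"
| "subst_lam k v (LApp t u) = LApp (subst_lam k v t) (subst_lam k v u)"
| "subst_lam k v (LTLam t) = LTLam (subst_lam k (ilift_lam 0 v) t)"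
| "subst_lam k v (LTApp t B) = LTApp (subst_lam k v t) B"

primrec isubst_lam :: "nat \<Rightarrow> 'v inh \<Rightarrow> 'v lam \<Rightarrow> 'v lam" where
  "isubst_lam k C (LVar i) = LVar i"
| "isubst_lam k C (LLam t) = LLam (isubst_lam k C t)"
| "isubst_lam k C (LApp t u) = LApp (isubst_lam k C t) (isubst_lam k C u)"
| "isubst_lam k C (LTLam t) = LTLam (isubst_lam (Suc k) (ilift_inh 0 C) t)"
| "isubst_lam k C (LTApp t B) = LTApp (isubst_lam k C t) (isubst_inh k C B)"

inductive lam_red :: "'v lam \<Rightarrow> 'v lam \<Rightarrow> bool" where
  beta: "lam_red (LApp (LLam t) u) (subst_lam 0 u t)"
| ibeta: "lam_red (LTApp (LTLam t) B) (isubst_lam 0 B t)"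
| LLam: "lam_red t t' \<Longrightarrow> lam_red (LLam t) (LLam t')"
| LAppL: "lam_red t t' \<Longrightarrow> lam_red (LApp t u) (LApp t' u)"
| LAppR: "lam_red u u' \<Longrightarrow> lam_red (LApp t u) (LApp t u')"
| LTLam: "lam_red t t' \<Longrightarrow> lam_red (LTLam t) (LTLam t')"
| LTAppL: "lam_red t t' \<Longrightarrow> lam_red (LTApp t B) (LTApp t' B)"
| LTAppR: "beta0 B B' \<Longrightarrow> lam_red (LTApp t B) (LTApp t B')"

subsection \<open>The systems without domain variables: \<open>\<lambda>\<omega>J\<^sup>m\<^sup>s\<^sup>e\<close> and \<open>\<lambda>\<omega>\<close>\<close>

definition omega_inh :: "'v inh \<Rightarrow> bool" where
  "omega_inh A \<longleftrightarrow> dvars_inh A = {}"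

definition omega_tm :: "'v tm \<Rightarrow> bool" where
  "omega_tm t \<longleftrightarrow> dvars_tm t = {}"

definition omega_lam :: "'v lam \<Rightarrow> bool" where
  "omega_lam t \<longleftrightarrow> dvars_lam t = {}"

definition tm_red_omega :: "'v tm \<Rightarrow> 'v tm \<Rightarrow> bool" where
  "tm_red_omega t u \<longleftrightarrow> omega_tm t \<and> omega_tm u \<and> tm_red t u"

definition lam_red_omega :: "'v lam \<Rightarrow> 'v lam \<Rightarrow> bool" where
  "lam_red_omega t u \<longleftrightarrow> omega_lam t \<and> omega_lam u \<and> lam_red t u"

subsection \<open>Closed proof terms of the target system\<close>

text \<open>\<open>n\<close> bounds the free inhabitant variables and \<open>k\<close> the free proof variables.\<close>

primrec fv_below_inh :: "nat \<Rightarrow> 'v inh \<Rightarrow> bool" where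
  "fv_below_inh n (IVar i) \<longleftrightarrow> i < n"
| "fv_below_inh n (ILam A) \<longleftrightarrow> fv_below_inh (Suc n) A"
| "fv_below_inh n (IApp A B) \<longleftrightarrow> fv_below_inh n A \<and> fv_below_inh n B"
| "fv_below_inh n (Imp A B) \<longleftrightarrow> fv_below_inh n A \<and> fv_below_inh n B"
| "fv_below_inh n (All D A) \<longleftrightarrow> fv_below_inh (Suc n) A"

primrec fv_below_lam :: "nat \<Rightarrow> nat \<Rightarrow> 'v lam \<Rightarrow> bool" where
  "fv_below_lam n k (LVar i) \<longleftrightarrow> i < k"
| "fv_below_lam n k (LLam t) \<longleftrightarrow> fv_below_lam n (Suc k) t"
| "fv_below_lam n k (LApp t u) \<longleftrightarrow> fv_below_lam n k t \<and> fv_below_lam n k u"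
| "fv_below_lam n k (LTLam t) \<longleftrightarrow> fv_below_lam (Suc n) k t"
| "fv_below_lam n k (LTApp t B) \<longleftrightarrow> fv_below_lam n k t \<and> fv_below_inh n B"

definition closed_lam :: "'v lam \<Rightarrow> bool" where
  "closed_lam t \<longleftrightarrow> fv_below_lam 0 0 t"

subsection \<open>The CGPS translation\<close>

text \<open>
  The translation depends on the fixed inhabitant variable \<open>\<bottom>\<close> (with index \<open>b\<close>), on the fixed
  proposition \<open>\<top>\<close> (the parameter \<open>T\<close>) and on the closed proof term \<open>s\<close>.  Passing under a binder of an
  inhabitant variable renames \<open>\<bottom>\<close> and \<open>\<top>\<close> accordingly; \<open>s\<close> is closed and thus needs no renaming.
\<close>

definition neg_inh :: "nat \<Rightarrow> 'v inh \<Rightarrow> 'v inh" where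
  "neg_inh b A = Imp A (IVar b)"

text \<open>\<open>star_inh b T A\<close> is \<open>A\<^sup>*\<close> and \<open>bar_inh b T A\<close> is \<open>A\<close> with an overline.\<close>

function star_inh :: "nat \<Rightarrow> 'v inh \<Rightarrow> 'v inh \<Rightarrow> 'v inh"
  and bar_inh :: "nat \<Rightarrow> 'v inh \<Rightarrow> 'v inh \<Rightarrow> 'v inh" where
  "star_inh b T (IVar i) = IVar i"
| "star_inh b T (ILam A) = ILam (star_inh (Suc b) (ilift_inh 0 T) A)"
| "star_inh b T (IApp A B) = IApp (star_inh b T A) (star_inh b T B)"
| "star_inh b T (Imp A B) = Imp (neg_inh b (bar_inh b T B)) (neg_inh b (bar_inh b T A))"
| "star_inh b T (All D A) = All D (bar_inh (Suc b) (ilift_inh 0 T) A)"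
| "bar_inh b T A = Imp T (neg_inh b (neg_inh b (star_inh b T A)))"
  by pat_completeness auto
termination
  by (relation "measure (\<lambda>p. case p of Inl (_, _, A) \<Rightarrow> 2 * size A
                                  | Inr (_, _, A) \<Rightarrow> Suc (2 * size A))") auto

text \<open>\<open>[t; u]\<close>\<close>

definition let_lam :: "'v lam \<Rightarrow> 'v lam \<Rightarrow> 'v lam" where
  "let_lam t u = LApp (LLam (lift_lam 0 t)) u"

lemma size_lift [simp]:
  fixes t :: "'v tm" and l :: "'v cot" and c :: "'v cmd"
  shows "size (lift_tm k t) = size t"
    and "size (lift_cot k l) = size l"
    and "size (lift_cmd k c) = size c"
  by (induction t and l and c arbitrary: k and k and k) simp_all

text \<open>
  \<open>cps_tm b T s t G K\<close> is \<open>(t : G, K)\<close>, likewise \<open>cps_cot\<close> and \<open>cps_cmd\<close>; \<open>cgps b T s t\<close> is \<open>t\<close>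
  with an overline.  Applications of \<open>lift_lam\<close> express the freshness of \<open>w\<close>, \<open>m\<close> and \<open>x\<close>, and
  those of \<open>lift_tm\<close> the freshness of \<open>g\<close> (index \<open>1\<close>) and \<open>k\<close> (index \<open>0\<close>).
\<close>

function cps_tm :: "nat \<Rightarrow> 'v inh \<Rightarrow> 'v lam \<Rightarrow> 'v tm \<Rightarrow> 'v lam \<Rightarrow> 'v lam \<Rightarrow> 'v lam"
  and cps_cot :: "nat \<Rightarrow> 'v inh \<Rightarrow> 'v lam \<Rightarrow> 'v cot \<Rightarrow> 'v lam \<Rightarrow> 'v lam \<Rightarrow> 'v lam"
  and cps_cmd :: "nat \<Rightarrow> 'v inh \<Rightarrow> 'v lam \<Rightarrow> 'v cmd \<Rightarrow> 'v lam \<Rightarrow> 'v lam \<Rightarrow> 'v lam"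
  and cgps :: "nat \<Rightarrow> 'v inh \<Rightarrow> 'v lam \<Rightarrow> 'v tm \<Rightarrow> 'v lam" where
  "cps_tm b T s (Var i) G K = LApp (LApp (LVar i) (LApp s G)) K"
| "cps_tm b T s (Lam t) G K =
     let_lam (LApp K (LLam (LLam (LApp (LVar 1) (lift_lam 1 (cgps b T s t)))))) G"
| "cps_tm b T s (TLam t) G K =
     let_lam (LApp K (LTLam (cgps (Suc b) (ilift_inh 0 T) s t))) G"
| "cps_tm b T s (Brc c) G K = cps_cmd b T s c (LApp s G) K"
| "cps_cot b T s CNil G K = LLam (LApp (LApp (LVar 0) (lift_lam 0 G)) (lift_lam 0 K))"
| "cps_cot b T s (CTm u l) G K =
     LLam (LApp (LApp (LVar 0) (lift_lam 0 G))
       (LLam (LApp (LApp (LVar 0) (lift_lam 0 (lift_lam 0 (cps_cot b T s l G K))))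
         (lift_lam 0 (lift_lam 0 (cgps b T s u))))))"
| "cps_cot b T s (CInh B l) G K =
     LLam (LApp (LApp (LVar 0) (lift_lam 0 G))
       (LLam (LApp (lift_lam 0 (lift_lam 0 (cps_cot b T s l G K)))
         (LTApp (LVar 0) (star_inh b T B)))))"
| "cps_cot b T s (Sel c) G K = LLam (cps_cmd b T s c (lift_lam 0 G) (lift_lam 0 K))"
| "cps_cmd b T s (Cut t CNil) G K = cps_tm b T s t G K"
| "cps_cmd b T s (Cut t (CTm u l)) G K =
     cps_tm b T s t G
       (LLam (LApp (LApp (LVar 0) (lift_lam 0 (cps_cot b T s l G K)))
         (lift_lam 0 (cgps b T s u))))"
| "cps_cmd b T s (Cut t (CInh B l)) G K =
     cps_tm b T s t G
       (LLam (LApp (lift_lam 0 (cps_cot b T s l G K)) (LTApp (LVar 0) (star_inh b T B))))"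
| "cps_cmd b T s (Cut t (Sel c)) G K = LApp (cps_cot b T s (Sel c) G K) (cgps b T s t)"
| "cgps b T s t = LLam (LLam (cps_tm b T s (lift_tm 0 (lift_tm 0 t)) (LVar 1) (LVar 0)))"
  by pat_completeness auto
termination
  by (relation "measure (\<lambda>p. case p of
         Inl (Inl (_, _, _, t, _)) \<Rightarrow> 2 * size t
       | Inl (Inr (_, _, _, l, _)) \<Rightarrow> 2 * size l
       | Inr (Inl (_, _, _, c, _)) \<Rightarrow> 2 * size c
       | Inr (Inr (_, _, _, t)) \<Rightarrow> Suc (2 * size t))") auto

end

theory Submission
  imports Defs
begin

text \<open>
  Every expression \<open>(t : G, K)\<close> contains \<open>G\<close> and \<open>K\<close>, so the garbage \<open>G\<^sup>+ = s G\<close> left behind by the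
  braces of a \<open>\<pi>\<close>- or \<open>\<epsilon>\<close>-redex, or by the variable of a \<open>\<mu>\<close>-redex, provides at least one target step
  where plain continuation passing would identify both sides.  The other rules contract a \<open>\<beta>\<close>-redex of the
  target and then rely on \<open>[t/x](u : G, K) \<rightarrow>\<^sup>* ([t/x]u : [t/x]G, [t/x]K)\<close>, with the translation of \<open>t\<close>
  substituted on the left and in \<open>G\<close> and \<open>K\<close>.  The system without domain variables is handled by
  observing that target reduction creates no domain variables.
\<close>

section \<open>Lifting and substitution of inhabitants\<close>

lemma ilift_ilift_inh:
  "i \<le> k \<Longrightarrow> ilift_inh i (ilift_inh k A) = ilift_inh (Suc k) (ilift_inh i A)"
  by (induction A arbitrary: i k) auto

lemma isubst_ilift_inh [simp]: "isubst_inh k C (ilift_inh k A) = A"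
  by (induction A arbitrary: k C) auto

section \<open>Lifting and substitution in the target system\<close>

lemma lift_lift_lam:
  "i \<le> k \<Longrightarrow> lift_lam i (lift_lam k t) = lift_lam (Suc k) (lift_lam i t)"
  by (induction t arbitrary: i k) auto

lemma ilift_lift_lam: "ilift_lam k (lift_lam j t) = lift_lam j (ilift_lam k t)"
  by (induction t arbitrary: j k) auto

lemma ilift_ilift_lam:
  "i \<le> k \<Longrightarrow> ilift_lam i (ilift_lam k t) = ilift_lam (Suc k) (ilift_lam i t)"
  by (induction t arbitrary: i k) (auto simp: ilift_ilift_inh)

lemma subst_lift_lam [simp]: "subst_lam k v (lift_lam k t) = t"
  by (induction t arbitrary: k v) auto

lemma isubst_ilift_lam [simp]: "isubst_lam k C (ilift_lam k t) = t"
  by (induction t arbitrary: k C) auto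

lemma isubst_lift_lam: "isubst_lam k C (lift_lam j t) = lift_lam j (isubst_lam k C t)"
  by (induction t arbitrary: j k C) auto

lemma lift_subst_lam_le:
  "i \<le> j \<Longrightarrow> lift_lam i (subst_lam j v t) = subst_lam (Suc j) (lift_lam i v) (lift_lam i t)"
  by (induction t arbitrary: i j v) (auto simp: lift_lift_lam ilift_lift_lam)

lemma lift_subst_lam_ge:
  "j \<le> i \<Longrightarrow> lift_lam i (subst_lam j v t) = subst_lam j (lift_lam i v) (lift_lam (Suc i) t)"
  by (induction t arbitrary: i j v) (auto simp: lift_lift_lam ilift_lift_lam)

lemma ilift_subst_lam:
  "ilift_lam i (subst_lam j v t) = subst_lam j (ilift_lam i v) (ilift_lam i t)"
  by (induction t arbitrary: i j v) (auto simp: ilift_lift_lam ilift_ilift_lam)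

lemma subst_subst_lam:
  "j \<le> k \<Longrightarrow> subst_lam k v (subst_lam j u t) =
     subst_lam j (subst_lam k v u) (subst_lam (Suc k) (lift_lam j v) t)"
  by (induction t arbitrary: j k u v)
    (auto simp: lift_lift_lam lift_subst_lam_le ilift_lift_lam ilift_subst_lam)

lemma subst_isubst_lam:
  "subst_lam k v (isubst_lam j C t) = isubst_lam j C (subst_lam k (ilift_lam j v) t)"
  by (induction t arbitrary: j k v C) (auto simp: ilift_ilift_lam ilift_lift_lam)

lemma lam_red_lift: "lam_red t u \<Longrightarrow> lam_red (lift_lam k t) (lift_lam k u)"
  by (induction arbitrary: k rule: lam_red.induct)
    (auto simp: lift_subst_lam_ge isubst_lift_lam[symmetric] intro: lam_red.intros)

text \<open>In the final theorem this carries the reduction of \<open>s\<close> applied to a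
  variable over to \<open>s\<close> applied to an arbitrary term.\<close>

lemma lam_red_subst: "lam_red t u \<Longrightarrow> lam_red (subst_lam k v t) (subst_lam k v u)"
  by (induction arbitrary: k v rule: lam_red.induct)
    (auto simp: subst_subst_lam subst_isubst_lam intro: lam_red.intros)

text \<open>Operations acting at or above the bounds on free indices change nothing. The inductions
  range over all bounds, as each binder raises bound and index together; closedness is the case
  where both bounds are \<open>0\<close>.\<close>

lemma closed_lam_invariant:
  assumes "closed_lam s"
  shows "lift_lam k s = s" "ilift_lam k s = s" "subst_lam k v s = s" "isubst_lam k C s = s"
proof -
  have inh: "ilift_inh j A = A \<and> isubst_inh j D A = A" if "fv_below_inh n A" "n \<le> j"
    for n j D and A :: "'a inh"
    using that
  proof (induction A arbitrary: n j D)
    case (ILam A)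
    then show ?case using ILam.IH[of "Suc n" "Suc j" "ilift_inh 0 D"] by simp
  next
    case (All E A)
    then show ?case using All.IH[of "Suc n" "Suc j" "ilift_inh 0 D"] by simp
  next
    case (IApp A B)
    then show ?case using IApp.IH[of n j D] by simp
  next
    case (Imp A B)
    then show ?case using Imp.IH[of n j D] by simp
  qed simp
  have "lift_lam i t = t \<and> ilift_lam j t = t \<and> subst_lam i v t = t \<and> isubst_lam j C t = t"
    if "fv_below_lam n m t" "n \<le> j" "m \<le> i" for n m i j v C and t :: "'a lam"
    using that
  proof (induction t arbitrary: n m i j v C)
    case (LLam t)
    then show ?case using LLam.IH[of n "Suc m" j "Suc i" "lift_lam 0 v" C] by simp
  next
    case (LApp t u)
    then show ?case using LApp.IH[of n m j i v C] by simp
  next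
    case (LTLam t)
    then show ?case using LTLam.IH[of "Suc n" m "Suc j" i "ilift_lam 0 v" "ilift_inh 0 C"] by simp
  next
    case (LTApp t B)
    then show ?case using LTApp.IH[of n m j i v C] inh[of n B j C] by simp
  qed simp
  with assms show "lift_lam k s = s" "ilift_lam k s = s" "subst_lam k v s = s" "isubst_lam k C s = s"
    unfolding closed_lam_def by blast+
qed

section \<open>Congruence and stability of many-step reduction\<close>

lemma tranclp_map:
  assumes "\<And>x y. r x y \<Longrightarrow> q (f x) (f y)"
  shows "r\<^sup>+\<^sup>+ x y \<Longrightarrow> q\<^sup>+\<^sup>+ (f x) (f y)"
  by (induction rule: tranclp_induct) (auto intro: assms tranclp.intros)

lemma rtranclp_map:
  assumes "\<And>x y. r x y \<Longrightarrow> q (f x) (f y)"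
  shows "r\<^sup>*\<^sup>* x y \<Longrightarrow> q\<^sup>*\<^sup>* (f x) (f y)"
  by (induction rule: rtranclp_induct) (auto intro: assms rtranclp.intros)

lemma reds_lift:
  "lam_red\<^sup>+\<^sup>+ t u \<Longrightarrow> lam_red\<^sup>+\<^sup>+ (lift_lam k t) (lift_lam k u)"
  "lam_red\<^sup>*\<^sup>* t u \<Longrightarrow> lam_red\<^sup>*\<^sup>* (lift_lam k t) (lift_lam k u)"
  by (erule tranclp_map[of lam_red lam_red "\<lambda>t. lift_lam k t", rotated]
      rtranclp_map[of lam_red lam_red "\<lambda>t. lift_lam k t", rotated], erule lam_red_lift)+

lemma reds_LLam:
  "lam_red\<^sup>+\<^sup>+ t u \<Longrightarrow> lam_red\<^sup>+\<^sup>+ (LLam t) (LLam u)"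
  "lam_red\<^sup>*\<^sup>* t u \<Longrightarrow> lam_red\<^sup>*\<^sup>* (LLam t) (LLam u)"
  by (erule tranclp_map[of lam_red lam_red "\<lambda>t. LLam t", rotated]
      rtranclp_map[of lam_red lam_red "\<lambda>t. LLam t", rotated], erule lam_red.LLam)+

lemma reds_LTLam:
  "lam_red\<^sup>+\<^sup>+ t u \<Longrightarrow> lam_red\<^sup>+\<^sup>+ (LTLam t) (LTLam u)"
  "lam_red\<^sup>*\<^sup>* t u \<Longrightarrow> lam_red\<^sup>*\<^sup>* (LTLam t) (LTLam u)"
  by (erule tranclp_map[of lam_red lam_red "\<lambda>t. LTLam t", rotated]
      rtranclp_map[of lam_red lam_red "\<lambda>t. LTLam t", rotated], erule lam_red.LTLam)+

lemma reds_LAppL: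
  "lam_red\<^sup>+\<^sup>+ t u \<Longrightarrow> lam_red\<^sup>+\<^sup>+ (LApp t v) (LApp u v)"
  "lam_red\<^sup>*\<^sup>* t u \<Longrightarrow> lam_red\<^sup>*\<^sup>* (LApp t v) (LApp u v)"
  by (erule tranclp_map[of lam_red lam_red "\<lambda>t. LApp t v", rotated]
      rtranclp_map[of lam_red lam_red "\<lambda>t. LApp t v", rotated], erule lam_red.LAppL)+

lemma reds_LAppR:
  "lam_red\<^sup>+\<^sup>+ t u \<Longrightarrow> lam_red\<^sup>+\<^sup>+ (LApp v t) (LApp v u)"
  "lam_red\<^sup>*\<^sup>* t u \<Longrightarrow> lam_red\<^sup>*\<^sup>* (LApp v t) (LApp v u)"
  by (erule tranclp_map[of lam_red lam_red "\<lambda>t. LApp v t", rotated]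
      rtranclp_map[of lam_red lam_red "\<lambda>t. LApp v t", rotated], erule lam_red.LAppR)+

lemma reds_LApp:
  "lam_red\<^sup>+\<^sup>+ t t' \<Longrightarrow> lam_red\<^sup>+\<^sup>+ u u' \<Longrightarrow> lam_red\<^sup>+\<^sup>+ (LApp t u) (LApp t' u')"
  "lam_red\<^sup>*\<^sup>* t t' \<Longrightarrow> lam_red\<^sup>*\<^sup>* u u' \<Longrightarrow> lam_red\<^sup>*\<^sup>* (LApp t u) (LApp t' u')"
  by (meson reds_LAppL reds_LAppR tranclp_trans rtranclp_trans)+

lemma reds_let_lam:
  "lam_red\<^sup>+\<^sup>+ t t' \<Longrightarrow> lam_red\<^sup>+\<^sup>+ (let_lam t u) (let_lam t' u)"
  "lam_red\<^sup>+\<^sup>+ u u' \<Longrightarrow> lam_red\<^sup>+\<^sup>+ (let_lam t u) (let_lam t u')"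
  "lam_red\<^sup>*\<^sup>* t t' \<Longrightarrow> lam_red\<^sup>*\<^sup>* (let_lam t u) (let_lam t' u)"
  unfolding let_lam_def by (intro reds_LAppL reds_LAppR reds_LLam reds_lift; assumption)+

lemma let_lam_red: "lam_red (let_lam t u) t"
  unfolding let_lam_def by (metis lam_red.beta subst_lift_lam)

lemma lift_let_lam: "lift_lam k (let_lam t u) = let_lam (lift_lam k t) (lift_lam k u)"
  by (simp add: let_lam_def lift_lift_lam)

lemma ilift_let_lam: "ilift_lam k (let_lam t u) = let_lam (ilift_lam k t) (ilift_lam k u)"
  by (simp add: let_lam_def ilift_lift_lam)

lemma subst_let_lam: "subst_lam k v (let_lam t u) = let_lam (subst_lam k v t) (subst_lam k v u)"
  by (simp add: let_lam_def lift_subst_lam_le)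

lemma isubst_let_lam:
  "isubst_lam k C (let_lam t u) = let_lam (isubst_lam k C t) (isubst_lam k C u)"
  by (simp add: let_lam_def isubst_lift_lam)

section \<open>Lifting and substitution in the source system\<close>

lemma lift_lift_tm:
  fixes t :: "'v tm" and l :: "'v cot" and c :: "'v cmd"
  shows "i \<le> k \<Longrightarrow> lift_tm i (lift_tm k t) = lift_tm (Suc k) (lift_tm i t)"
    and "i \<le> k \<Longrightarrow> lift_cot i (lift_cot k l) = lift_cot (Suc k) (lift_cot i l)"
    and "i \<le> k \<Longrightarrow> lift_cmd i (lift_cmd k c) = lift_cmd (Suc k) (lift_cmd i c)"
  by (induction t and l and c arbitrary: i k and i k and i k) auto

lemma ilift_lift_tm:
  fixes t :: "'v tm" and l :: "'v cot" and c :: "'v cmd"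
  shows "ilift_tm i (lift_tm k t) = lift_tm k (ilift_tm i t)"
    and "ilift_cot i (lift_cot k l) = lift_cot k (ilift_cot i l)"
    and "ilift_cmd i (lift_cmd k c) = lift_cmd k (ilift_cmd i c)"
  by (induction t and l and c arbitrary: i k and i k and i k) auto

lemma isubst_lift_tm:
  fixes t :: "'v tm" and l :: "'v cot" and c :: "'v cmd"
  shows "isubst_tm i C (lift_tm k t) = lift_tm k (isubst_tm i C t)"
    and "isubst_cot i C (lift_cot k l) = lift_cot k (isubst_cot i C l)"
    and "isubst_cmd i C (lift_cmd k c) = lift_cmd k (isubst_cmd i C c)"
  by (induction t and l and c arbitrary: i k C and i k C and i k C) auto

lemma subst_lift_tm [simp]:
  fixes t :: "'v tm" and l :: "'v cot" and c :: "'v cmd"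
  shows "subst_tm k v (lift_tm k t) = t"
    and "subst_cot k v (lift_cot k l) = l"
    and "subst_cmd k v (lift_cmd k c) = c"
  by (induction t and l and c arbitrary: k v and k v and k v) auto

text \<open>Lifting above \<open>k\<close> makes room for a second variable, which the substitution
  identifies with \<open>k\<close> again. This undoes the renaming in a \<open>\<mu>\<close>-redex
  whose co-term is itself a selection.\<close>

lemma subst_Var_lift_Suc_tm:
  fixes t :: "'v tm" and l :: "'v cot" and c :: "'v cmd"
  shows "subst_tm k (Var k) (lift_tm (Suc k) t) = t"
    and "subst_cot k (Var k) (lift_cot (Suc k) l) = l"
    and "subst_cmd k (Var k) (lift_cmd (Suc k) c) = c"
  by (induction t and l and c arbitrary: k and k and k) auto

lemma lift_subst_tm_le:
  fixes t :: "'v tm" and l :: "'v cot" and c :: "'v cmd"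
  shows "i \<le> j \<Longrightarrow> lift_tm i (subst_tm j v t) = subst_tm (Suc j) (lift_tm i v) (lift_tm i t)"
    and "i \<le> j \<Longrightarrow> lift_cot i (subst_cot j v l) = subst_cot (Suc j) (lift_tm i v) (lift_cot i l)"
    and "i \<le> j \<Longrightarrow> lift_cmd i (subst_cmd j v c) = subst_cmd (Suc j) (lift_tm i v) (lift_cmd i c)"
  by (induction t and l and c arbitrary: i j v and i j v and i j v)
    (auto simp: lift_lift_tm ilift_lift_tm)

lemma lift_subst_tm_ge:
  fixes t :: "'v tm" and l :: "'v cot" and c :: "'v cmd"
  shows "j \<le> i \<Longrightarrow> lift_tm i (subst_tm j v t) = subst_tm j (lift_tm i v) (lift_tm (Suc i) t)"
    and "j \<le> i \<Longrightarrow> lift_cot i (subst_cot j v l) = subst_cot j (lift_tm i v) (lift_cot (Suc i) l)"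
    and "j \<le> i \<Longrightarrow> lift_cmd i (subst_cmd j v c) = subst_cmd j (lift_tm i v) (lift_cmd (Suc i) c)"
  by (induction t and l and c arbitrary: i j v and i j v and i j v)
    (auto simp: lift_lift_tm ilift_lift_tm)

lemma lift_append_cot:
  "lift_cot k (append_cot l l') = append_cot (lift_cot k l) (lift_cot k l')"
  by (induction l l' arbitrary: k rule: append_cot.induct) (auto simp: lift_lift_tm)

lemma ectx_lift: "ectx E \<Longrightarrow> ectx (lift_cot k E)"
  by (auto elim!: ectx.cases intro: ectx.intros)

text \<open>Needed because \<open>cgps\<close> lifts its argument past \<open>g\<close> and
  \<open>k\<close> before translating it.\<close>

lemma source_red_lift:
  fixes t t' :: "'v tm" and l l' :: "'v cot" and c c' :: "'v cmd"
  shows "tm_red t t' \<Longrightarrow> tm_red (lift_tm k t) (lift_tm k t')"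
    and "cot_red l l' \<Longrightarrow> cot_red (lift_cot k l) (lift_cot k l')"
    and "cmd_red c c' \<Longrightarrow> cmd_red (lift_cmd k c) (lift_cmd k c')"
proof (induction arbitrary: k and k and k rule: tm_red_cot_red_cmd_red.inducts)
  case (beta1 t u l)
  \<comment> \<open>The commutation law is read backwards, so that \<open>lift_cot 0\<close> ends up
    outermost, as the contractum of the rule requires.\<close>
  then show ?case by (simp add: lift_lift_tm[symmetric] tm_red_cot_red_cmd_red.beta1)
next
  case (beta2 t B l)
  then show ?case by (simp add: isubst_lift_tm[symmetric] tm_red_cot_red_cmd_red.beta2)
next
  case (mu l)
  then show ?case by (simp add: lift_lift_tm[symmetric] tm_red_cot_red_cmd_red.mu)
qed (auto simp: lift_append_cot ectx_lift lift_subst_tm_ge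
    intro: tm_red_cot_red_cmd_red.intros)

section \<open>The translation of inhabitants\<close>

text \<open>By \<open>k \<le> b\<close> the new variable is inserted at or below the index of
  \<open>\<bottom>\<close>, which therefore becomes \<open>Suc b\<close>.\<close>

lemma ilift_star:
  "k \<le> b \<Longrightarrow> ilift_inh k (star_inh b T A) = star_inh (Suc b) (ilift_inh k T) (ilift_inh k A)"
  by (induction A arbitrary: k b T) (auto simp: neg_inh_def ilift_ilift_inh)

text \<open>Since \<open>k \<le> b\<close>, the substituted variable differs from
  \<open>\<bottom>\<close>, whose index drops from \<open>Suc b\<close> back to \<open>b\<close>;
  likewise the substitution cancels the lifting of \<open>T\<close>.\<close>

lemma isubst_star:
  "k \<le> b \<Longrightarrow> isubst_inh k (star_inh b T C) (star_inh (Suc b) (ilift_inh k T) A) =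
     star_inh b T (isubst_inh k C A)"
  by (induction A arbitrary: k b T C) (auto simp: neg_inh_def ilift_ilift_inh ilift_star)

lemma beta0_star: "beta0 A B \<Longrightarrow> beta0 (star_inh b T A) (star_inh b T B)"
proof (induction arbitrary: b T rule: beta0.induct)
  case (beta0 A B)
  show ?case
    by (simp add: isubst_star[symmetric, of 0, simplified] beta0.beta0)
qed (auto simp: neg_inh_def intro!: beta0.intros)

section \<open>The translation commutes with lifting and substitution of inhabitants\<close>

text \<open>
  \<open>S\<close> is the property of \<open>cgps\<close>; it passes through two liftings, hence it is not covered by
  structural induction.
\<close>

lemma cps_induct [case_names Var Lam TLam Brc CNil CTm CInh Sel Cut_CNil Cut_CTm Cut_CInh Cut_Sel cgps]:
  assumes "\<And>i. P (Var i)"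
    and "\<And>t. S t \<Longrightarrow> P (Lam t)"
    and "\<And>t. S t \<Longrightarrow> P (TLam t)"
    and "\<And>c. R c \<Longrightarrow> P (Brc c)"
    and "Q CNil"
    and "\<And>u l. S u \<Longrightarrow> Q l \<Longrightarrow> Q (CTm u l)"
    and "\<And>B l. Q l \<Longrightarrow> Q (CInh B l)"
    and "\<And>c. R c \<Longrightarrow> Q (Sel c)"
    and "\<And>t. P t \<Longrightarrow> R (Cut t CNil)"
    \<comment> \<open>The translation of this cut does not call that of \<open>CTm u l\<close>. The
      hypothesis on the whole co-term follows from those on \<open>u\<close> and \<open>l\<close>;
      it is there for reductions inside the co-term of a cut.\<close>
    and "\<And>t u l. P t \<Longrightarrow> S u \<Longrightarrow> Q l \<Longrightarrow> Q (CTm u l) \<Longrightarrow> R (Cut t (CTm u l))"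
    and "\<And>t B l. P t \<Longrightarrow> Q l \<Longrightarrow> Q (CInh B l) \<Longrightarrow> R (Cut t (CInh B l))"
    and "\<And>t c. S t \<Longrightarrow> Q (Sel c) \<Longrightarrow> R (Cut t (Sel c))"
    and "\<And>t. P (lift_tm 0 (lift_tm 0 t)) \<Longrightarrow> S t"
  shows "P t" and "Q l" and "R c" and "S t'"
proof -
  note ind = cps_tm_cps_cot_cps_cmd_cgps.induct
    [of "\<lambda>_ _ _ t _ _. P t" "\<lambda>_ _ _ t. S t" "\<lambda>_ _ _ c _ _. R c" "\<lambda>_ _ _ l _ _. Q l"]
  show "P t" "Q l" "R c" "S t'"
    by (rule ind; blast intro: assms)+
qed

text \<open>Kept folded, so that the induction hypotheses about \<open>cgps\<close> remain
  applicable.\<close>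

declare cgps.simps [simp del]

lemma lift_cps:
  fixes t :: "'v tm" and l :: "'v cot" and c :: "'v cmd"
  assumes s: "closed_lam s"
  shows "lift_lam k (cps_tm b T s t G K) = cps_tm b T s (lift_tm k t) (lift_lam k G) (lift_lam k K)"
    and "lift_lam k (cps_cot b T s l G K) = cps_cot b T s (lift_cot k l) (lift_lam k G) (lift_lam k K)"
    and "lift_lam k (cps_cmd b T s c G K) = cps_cmd b T s (lift_cmd k c) (lift_lam k G) (lift_lam k K)"
    and lift_cgps: "lift_lam k (cgps b T s t') = cgps b T s (lift_tm k t')"
proof (induction t and l and c and t' arbitrary: k b T G K and k b T G K and k b T G K and k b T
    rule: cps_induct)
  case (Lam t)
  \<comment> \<open>In the translation of an abstraction \<open>x\<close> has index \<open>0\<close>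
    and the fresh \<open>w\<close> index \<open>1\<close>, whence the cutoff
    \<open>1\<close>.\<close>
  have "lift_lam (Suc (Suc k)) (lift_lam 1 (cgps b T s t)) =
      lift_lam 1 (cgps b T s (lift_tm (Suc k) t))"
    using lift_lift_lam[of 1 "Suc k" "cgps b T s t"] Lam[of "Suc k"] by simp
  then show ?case by (simp add: lift_let_lam)
next
  case (cgps t)
  then show ?case by (simp add: cgps.simps lift_lift_tm)
next
  case (CTm u l)
  \<comment> \<open>The cutoff moves inwards past the two freshness lifts, where it is
    \<open>k\<close>; fixing \<open>k\<close> in the hypotheses leaves those lifts outside.\<close>
  show ?case by (simp add: lift_lift_lam[symmetric] CTm(1)[of k] CTm(2)[of k])
next
  case (CInh B l)
  show ?case by (simp add: lift_lift_lam[symmetric] CInh[of k])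
next
  case (Cut_CTm t u l)
  show ?case by (simp add: lift_lift_lam[symmetric] Cut_CTm(1) Cut_CTm(2)[of k] Cut_CTm(3)[of k])
next
  case (Cut_CInh t B l)
  show ?case by (simp add: lift_lift_lam[symmetric] Cut_CInh(1) Cut_CInh(2)[of k])
qed (simp_all add: lift_let_lam lift_lift_lam closed_lam_invariant[OF s])

lemma ilift_cps:
  fixes t :: "'v tm" and l :: "'v cot" and c :: "'v cmd"
  assumes s: "closed_lam s"
  shows "k \<le> b \<Longrightarrow> ilift_lam k (cps_tm b T s t G K) =
      cps_tm (Suc b) (ilift_inh k T) s (ilift_tm k t) (ilift_lam k G) (ilift_lam k K)"
    and "k \<le> b \<Longrightarrow> ilift_lam k (cps_cot b T s l G K) =
      cps_cot (Suc b) (ilift_inh k T) s (ilift_cot k l) (ilift_lam k G) (ilift_lam k K)"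
    and "k \<le> b \<Longrightarrow> ilift_lam k (cps_cmd b T s c G K) =
      cps_cmd (Suc b) (ilift_inh k T) s (ilift_cmd k c) (ilift_lam k G) (ilift_lam k K)"
    and ilift_cgps: "k \<le> b \<Longrightarrow> ilift_lam k (cgps b T s t') =
      cgps (Suc b) (ilift_inh k T) s (ilift_tm k t')"
proof (induction t and l and c and t' arbitrary: k b T G K and k b T G K and k b T G K and k b T
    rule: cps_induct)
  case (cgps t)
  then show ?case by (simp add: cgps.simps ilift_lift_tm)
qed (simp_all add: ilift_let_lam ilift_lift_lam closed_lam_invariant[OF s] ilift_lift_tm
    ilift_ilift_inh ilift_star)

text \<open>This is an equation because inhabitant variables are translated to themselves.
  Substitution for proof variables commutes only up to reduction, see
  \<open>subst_cps\<close>.\<close>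

lemma isubst_cps:
  fixes t :: "'v tm" and l :: "'v cot" and c :: "'v cmd"
  assumes s: "closed_lam s"
  shows "k \<le> b \<Longrightarrow> isubst_lam k (star_inh b T C) (cps_tm (Suc b) (ilift_inh k T) s t G K) =
      cps_tm b T s (isubst_tm k C t) (isubst_lam k (star_inh b T C) G) (isubst_lam k (star_inh b T C) K)"
    and "k \<le> b \<Longrightarrow> isubst_lam k (star_inh b T C) (cps_cot (Suc b) (ilift_inh k T) s l G K) =
      cps_cot b T s (isubst_cot k C l) (isubst_lam k (star_inh b T C) G) (isubst_lam k (star_inh b T C) K)"
    and "k \<le> b \<Longrightarrow> isubst_lam k (star_inh b T C) (cps_cmd (Suc b) (ilift_inh k T) s c G K) =
      cps_cmd b T s (isubst_cmd k C c) (isubst_lam k (star_inh b T C) G) (isubst_lam k (star_inh b T C) K)"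
    and isubst_cgps: "k \<le> b \<Longrightarrow> isubst_lam k (star_inh b T C) (cgps (Suc b) (ilift_inh k T) s t') =
      cgps b T s (isubst_tm k C t')"
proof (induction t and l and c and t' arbitrary: k b T G K C and k b T G K C and k b T G K C and k b T C
    rule: cps_induct)
  case (cgps t)
  then show ?case by (simp add: cgps.simps isubst_lift_tm)
qed (simp_all add: isubst_let_lam isubst_lift_lam closed_lam_invariant[OF s] isubst_lift_tm
    ilift_ilift_inh ilift_star isubst_star)

section \<open>Reductions between translated expressions\<close>

text \<open>The substituted variable occurs in \<open>G\<close> and \<open>K\<close> only. This is
  how the placeholders \<open>g\<close> and \<open>k\<close> in \<open>cgps\<close> are instantiated
  without touching the source expression.\<close>

lemma subst_lift_cps:
  fixes t :: "'v tm" and l :: "'v cot" and c :: "'v cmd"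
  assumes s: "closed_lam s"
  shows "subst_lam k v (cps_tm b T s (lift_tm k t) G K) =
      cps_tm b T s t (subst_lam k v G) (subst_lam k v K)"
    and "subst_lam k v (cps_cot b T s (lift_cot k l) G K) =
      cps_cot b T s l (subst_lam k v G) (subst_lam k v K)"
    and "subst_lam k v (cps_cmd b T s (lift_cmd k c) G K) =
      cps_cmd b T s c (subst_lam k v G) (subst_lam k v K)"
    and "subst_lam k v (cgps b T s (lift_tm k t')) = cgps b T s t'"
proof (induction t and l and c and t' arbitrary: k v b T G K and k v b T G K and k v b T G K and k v b T
    rule: cps_induct)
  case (Lam t)
  have "subst_lam (Suc (Suc k)) (lift_lam 0 (lift_lam 0 v)) (lift_lam 1 (cgps b T s (lift_tm (Suc k) t))) =
      lift_lam 1 (cgps b T s t)"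
    using lift_subst_lam_le[of 1 "Suc k" "lift_lam 0 v" "cgps b T s (lift_tm (Suc k) t)"]
      Lam[of "Suc k"]
    by (simp add: lift_lift_lam)
  then show ?case by (simp add: subst_let_lam)
next
  case (cgps t)
  then show ?case by (simp add: cgps.simps lift_lift_tm)
next
  case (CTm u l)
  show ?case by (simp add: lift_subst_lam_le[symmetric] CTm(1)[of k v] CTm(2)[of k v])
next
  case (CInh B l)
  show ?case by (simp add: lift_subst_lam_le[symmetric] CInh[of k v])
next
  case (Cut_CTm t u l)
  show ?case
    by (simp add: lift_subst_lam_le[symmetric] Cut_CTm(1) Cut_CTm(2)[of k v] Cut_CTm(3)[of k v])
next
  case (Cut_CInh t B l)
  show ?case by (simp add: lift_subst_lam_le[symmetric] Cut_CInh(1) Cut_CInh(2)[of k v])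
qed (simp_all add: subst_let_lam lift_subst_lam_le closed_lam_invariant[OF s])

text \<open>
  The trivial last conclusion only matches the fourth predicate of the induction rule.
\<close>

lemma cps_mono_K:
  fixes t t' :: "'v tm" and l :: "'v cot" and c :: "'v cmd"
  shows "lam_red\<^sup>+\<^sup>+ K K' \<Longrightarrow> lam_red\<^sup>+\<^sup>+ (cps_tm b T s t G K) (cps_tm b T s t G K')"
    and "lam_red\<^sup>+\<^sup>+ K K' \<Longrightarrow> lam_red\<^sup>+\<^sup>+ (cps_cot b T s l G K) (cps_cot b T s l G K')"
    and "lam_red\<^sup>+\<^sup>+ K K' \<Longrightarrow> lam_red\<^sup>+\<^sup>+ (cps_cmd b T s c G K) (cps_cmd b T s c G K')"
    and "t' = t'"
proof (induction t and l and c and t' arbitrary: b T G K K' and b T G K K' and b T G K K' and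
    rule: cps_induct)
qed (simp_all add: reds_LLam reds_LAppL reds_LAppR reds_let_lam reds_lift)

lemma cps_mono_G:
  fixes t t' :: "'v tm" and l :: "'v cot" and c :: "'v cmd"
  shows "lam_red\<^sup>+\<^sup>+ G G' \<Longrightarrow> lam_red\<^sup>+\<^sup>+ (cps_tm b T s t G K) (cps_tm b T s t G' K)"
    and "lam_red\<^sup>+\<^sup>+ G G' \<Longrightarrow> lam_red\<^sup>+\<^sup>+ (cps_cot b T s l G K) (cps_cot b T s l G' K)"
    and "lam_red\<^sup>+\<^sup>+ G G' \<Longrightarrow> lam_red\<^sup>+\<^sup>+ (cps_cmd b T s c G K) (cps_cmd b T s c G' K)"
    and "t' = t'"
proof (induction t and l and c and t' arbitrary: b T G G' K and b T G G' K and b T G G' K and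
    rule: cps_induct)
  case (CTm u l)
  then show ?case
    by (simp add: reds_LLam reds_LApp reds_LAppL reds_LAppR reds_lift)
next
  case (CInh B l)
  then show ?case
    by (simp add: reds_LLam reds_LApp reds_LAppL reds_LAppR reds_lift)
next
  case (Cut_CTm t u l)
  show ?case
    unfolding cps_cmd.simps
    \<comment> \<open>\<open>G\<close> occurs both in the continuation, through the translation of
      \<open>l\<close>, and as the garbage of \<open>t\<close>; the continuation is reduced
      first.\<close>
    by (rule tranclp_trans[OF cps_mono_K(1) Cut_CTm(1)])
      (intro reds_LLam reds_LAppL reds_LAppR reds_lift Cut_CTm)+
next
  case (Cut_CInh t B l)
  show ?case
    unfolding cps_cmd.simps
    by (rule tranclp_trans[OF cps_mono_K(1) Cut_CInh(1)])
      (intro reds_LLam reds_LAppL reds_LAppR reds_lift Cut_CInh)+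
qed (simp_all add: reds_LLam reds_LAppL reds_LAppR reds_let_lam reds_lift)

lemma cps_mono_star:
  assumes "lam_red\<^sup>*\<^sup>* K K'"
  shows "lam_red\<^sup>*\<^sup>* (cps_tm b T s t G K) (cps_tm b T s t G K')"
  using assms cps_mono_K(1)[of K K' b T s t G] by (metis rtranclpD rtranclp.rtrancl_refl tranclp_into_rtranclp)

text \<open>Two \<open>\<beta>\<close>-steps replace the placeholders \<open>g\<close> and
  \<open>k\<close> by \<open>G\<close> and \<open>K\<close>.\<close>

lemma cgps_app:
  assumes s: "closed_lam s"
  shows "lam_red\<^sup>*\<^sup>* (LApp (LApp (cgps b T s t) G) K) (cps_tm b T s t G K)"
proof -
  let ?M = "cps_tm b T s (lift_tm 0 (lift_tm 0 t)) (LVar 1) (LVar 0)"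
  have "subst_lam 0 G (LLam ?M) = LLam (cps_tm b T s (lift_tm 0 t) (lift_lam 0 G) (LVar 0))"
    using subst_lift_cps(1)[OF s, of 1 "lift_lam 0 G" b T "lift_tm 0 t" "LVar 1" "LVar 0"]
    by (simp add: lift_lift_tm)
  then have "lam_red (LApp (cgps b T s t) G) (LLam (cps_tm b T s (lift_tm 0 t) (lift_lam 0 G) (LVar 0)))"
    using lam_red.beta[of "LLam ?M" G] by (simp add: cgps.simps)
  moreover have "lam_red (LApp (LLam (cps_tm b T s (lift_tm 0 t) (lift_lam 0 G) (LVar 0))) K)
      (cps_tm b T s t G K)"
    using lam_red.beta[of "cps_tm b T s (lift_tm 0 t) (lift_lam 0 G) (LVar 0)" K]
    by (simp add: subst_lift_cps[OF s])
  ultimately show ?thesis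
    by (meson lam_red.LAppL converse_rtranclp_into_rtranclp rtranclp.rtrancl_refl)
qed

text \<open>
  \<open>cps_cont b T s E G K\<close> is the term \<open>K'\<close> with \<open>(t E : G, K) = (t : G, K')\<close>, for an evaluation
  context \<open>E\<close>; its value on selections is junk.
\<close>

fun cps_cont :: "nat \<Rightarrow> 'v inh \<Rightarrow> 'v lam \<Rightarrow> 'v cot \<Rightarrow> 'v lam \<Rightarrow> 'v lam \<Rightarrow> 'v lam" where
  "cps_cont b T s CNil G K = K"
| "cps_cont b T s (CTm u l) G K =
     LLam (LApp (LApp (LVar 0) (lift_lam 0 (cps_cot b T s l G K))) (lift_lam 0 (cgps b T s u)))"
| "cps_cont b T s (CInh B l) G K =
     LLam (LApp (lift_lam 0 (cps_cot b T s l G K)) (LTApp (LVar 0) (star_inh b T B)))"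
| "cps_cont b T s (Sel c) G K = K"

lemma cps_cmd_ectx: "ectx E \<Longrightarrow> cps_cmd b T s (Cut t E) G K = cps_tm b T s t G (cps_cont b T s E G K)"
  by (auto elim: ectx.cases)

text \<open>All evaluation contexts translate to the shape \<open>\<lambda>w. w G K'\<close>, with
  the same \<open>K'\<close> as in a cut, which avoids case distinctions later.\<close>

lemma cps_cot_ectx:
  "ectx E \<Longrightarrow> cps_cot b T s E G K =
     LLam (LApp (LApp (LVar 0) (lift_lam 0 G)) (lift_lam 0 (cps_cont b T s E G K)))"
  by (erule ectx.cases) (simp_all add: lift_lift_lam[symmetric])

lemma lift_cps_cont:
  "closed_lam s \<Longrightarrow> lift_lam k (cps_cont b T s l G K) =
     cps_cont b T s (lift_cot k l) (lift_lam k G) (lift_lam k K)"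
  by (cases l) (simp_all add: lift_lift_lam[symmetric] lift_cps lift_lift_tm)

lemma ectx_or_Sel: "ectx l \<or> (\<exists>c. l = Sel c)"
  by (cases l) (auto intro: ectx.intros)

text \<open>An appended context is absorbed into the continuation, with \<open>G\<close> unchanged.
  The two claims need each other: a selection contains a command, and a cut with
  \<open>u :: l\<close> or \<open>B :: l\<close> translates the co-term \<open>l\<close>.\<close>

lemma cps_append_cot:
  assumes s: "closed_lam s"
  shows "ectx E \<Longrightarrow> cps_cot b T s (append_cot l E) G K = cps_cot b T s l G (cps_cont b T s E G K) \<and>
    cps_cmd b T s (Cut t (append_cot l E)) G K = cps_cmd b T s (Cut t l) G (cps_cont b T s E G K)"
proof (induction l E arbitrary: G K t rule: append_cot.induct)
  case (4 t l l')
  then show ?case by (simp add: ectx_lift lift_cps_cont[OF s])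
qed (simp_all add: cps_cmd_ectx cps_cot_ectx)

text \<open>For a selection both sides are equal by definition. Otherwise
  \<open>(\<lambda>w. w G K')\<close> applied to the translated term passes it \<open>G\<close> and
  \<open>K'\<close>, and \<open>cgps_app\<close> finishes.\<close>

lemma cps_cot_app:
  assumes s: "closed_lam s"
  shows "lam_red\<^sup>*\<^sup>* (LApp (cps_cot b T s l G K) (cgps b T s t)) (cps_cmd b T s (Cut t l) G K)"
  using ectx_or_Sel[of l]
proof
  assume l: "ectx l"
  have "lam_red (LApp (cps_cot b T s l G K) (cgps b T s t))
      (LApp (LApp (cgps b T s t) G) (cps_cont b T s l G K))"
    using lam_red.beta[of "LApp (LApp (LVar 0) (lift_lam 0 G)) (lift_lam 0 (cps_cont b T s l G K))"]
    by (simp add: cps_cot_ectx[OF l])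
  with cgps_app[OF s] show ?thesis
    unfolding cps_cmd_ectx[OF l] by (rule converse_rtranclp_into_rtranclp[rotated])
qed auto

section \<open>The translation simulates reduction\<close>

locale cgps_reduction =
  fixes s :: "'v lam"
  assumes s: "closed_lam s"
    and s_red: "lam_red\<^sup>+\<^sup>+ (LApp s G) G"
begin

text \<open>Reduction enters at the substituted variable: the translation of \<open>v\<close> is
  applied to \<open>G\<^sup>+\<close> and \<open>K\<close>, which takes administrative steps and the
  removal of \<open>s\<close> to reach \<open>(v : G, K)\<close>. The other cases are
  congruences.\<close>

lemma subst_cps:
  fixes t :: "'v tm" and l :: "'v cot" and c :: "'v cmd"
  shows "lam_red\<^sup>*\<^sup>* (subst_lam k (cgps b T s v) (cps_tm b T s t G K))
      (cps_tm b T s (subst_tm k v t) (subst_lam k (cgps b T s v) G) (subst_lam k (cgps b T s v) K))"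
    and "lam_red\<^sup>*\<^sup>* (subst_lam k (cgps b T s v) (cps_cot b T s l G K))
      (cps_cot b T s (subst_cot k v l) (subst_lam k (cgps b T s v) G) (subst_lam k (cgps b T s v) K))"
    and "lam_red\<^sup>*\<^sup>* (subst_lam k (cgps b T s v) (cps_cmd b T s c G K))
      (cps_cmd b T s (subst_cmd k v c) (subst_lam k (cgps b T s v) G) (subst_lam k (cgps b T s v) K))"
    and subst_cgps: "lam_red\<^sup>*\<^sup>* (subst_lam k (cgps b T s v) (cgps b T s t')) (cgps b T s (subst_tm k v t'))"
proof (induction t and l and c and t' arbitrary: k v b T G K and k v b T G K and k v b T G K and k v b T
    rule: cps_induct)
  case (Var i)
  have "lam_red\<^sup>*\<^sup>* (LApp (LApp (cgps b T s v) (LApp s G)) K) (cps_tm b T s v G K)" for G K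
    by (rule rtranclp_trans[OF cgps_app[OF s]]) (intro tranclp_into_rtranclp cps_mono_G s_red)
  then show ?case by (simp add: closed_lam_invariant[OF s])
next
  case (Lam t)
  have "lam_red\<^sup>*\<^sup>* (subst_lam (Suc (Suc k)) (lift_lam 0 (lift_lam 0 (cgps b T s v))) (lift_lam 1 (cgps b T s t)))
      (lift_lam 1 (cgps b T s (subst_tm (Suc k) (lift_tm 0 v) t)))"
    using reds_lift(2)[OF Lam[of "Suc k" b T "lift_tm 0 v"], of 1]
    by (simp add: lift_subst_lam_le lift_cgps[OF s] lift_lift_tm)
  then show ?case by (simp add: subst_let_lam reds_let_lam reds_LAppR reds_LLam)
next
  case (TLam t)
  then show ?case
    by (simp add: subst_let_lam ilift_cgps[OF s] reds_let_lam reds_LAppR reds_LTLam)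
next
  case (CTm u l)
  have "lam_red\<^sup>*\<^sup>* (lift_lam i (lift_lam j (subst_lam k (cgps b T s v) (cps_cot b T s l G K))))
      (lift_lam i (lift_lam j (cps_cot b T s (subst_cot k v l) (subst_lam k (cgps b T s v) G) (subst_lam k (cgps b T s v) K))))"
    "lam_red\<^sup>*\<^sup>* (lift_lam i (lift_lam j (subst_lam k (cgps b T s v) (cgps b T s u))))
      (lift_lam i (lift_lam j (cgps b T s (subst_tm k v u))))" for i j
    by (intro reds_lift CTm)+
  from this[of 0 0] show ?case
    by (simp add: lift_subst_lam_le reds_LLam reds_LAppR reds_LApp)
next
  case (CInh B l)
  have "lam_red\<^sup>*\<^sup>* (lift_lam i (lift_lam j (subst_lam k (cgps b T s v) (cps_cot b T s l G K))))
      (lift_lam i (lift_lam j (cps_cot b T s (subst_cot k v l) (subst_lam k (cgps b T s v) G) (subst_lam k (cgps b T s v) K))))"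
    for i j
    by (intro reds_lift CInh)
  from this[of 0 0] show ?case
    by (simp add: lift_subst_lam_le reds_LLam reds_LAppR reds_LAppL)
next
  case (Sel c)
  then show ?case
    by (simp add: lift_subst_lam_le reds_LLam lift_cgps[OF s])
next
  case (Cut_CTm t u l)
  show ?case
    unfolding cps_cmd.simps subst_cmd.simps subst_cot.simps
    \<comment> \<open>The hypothesis on \<open>t\<close> leaves a substitution applied to the whole
      continuation; \<open>cps_mono_star\<close> then allows reducing inside it.\<close>
    by (rule rtranclp_trans[OF Cut_CTm(1) cps_mono_star],
        simp add: lift_subst_lam_le[symmetric, of 0, simplified])
      (intro reds_LLam reds_LApp reds_lift Cut_CTm rtranclp.rtrancl_refl)
next
  case (Cut_CInh t B l)
  show ?case
    unfolding cps_cmd.simps subst_cmd.simps subst_cot.simps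
    by (rule rtranclp_trans[OF Cut_CInh(1) cps_mono_star],
        simp add: lift_subst_lam_le[symmetric, of 0, simplified])
      (intro reds_LLam reds_LApp reds_lift Cut_CInh rtranclp.rtrancl_refl)
next
  case (Cut_Sel t c)
  show ?case
    using reds_LApp(2)[OF Cut_Sel(2)[of k b T v G K] Cut_Sel(1)[of k b T v]] by simp
next
  case (cgps t)
  then show ?case
    \<comment> \<open>Under the two binders the substituted index is \<open>Suc (Suc k)\<close>, so
      \<open>g\<close> and \<open>k\<close> at indices \<open>1\<close> and \<open>0\<close> stay
      fixed.\<close>
    using reds_LLam(2)[OF reds_LLam(2)[OF cgps[of "Suc (Suc k)" b T "lift_tm 0 (lift_tm 0 v)" "LVar 1" "LVar 0"]]]
    by (simp add: cgps.simps[of b T s t] cgps.simps[of b T s "subst_tm k v t"] lift_cgps[OF s] lift_subst_tm_le)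
next
  case (Brc c)
  show ?case using Brc[of k b T v "LApp s G" K] by (simp add: closed_lam_invariant[OF s])
qed (simp_all add: lift_subst_lam_le)

text \<open>Discarding the garbage of \<open>let_lam\<close> gives the first step. The continuation
  then hands the translations of \<open>l\<close> and \<open>u\<close> to the abstraction, and
  \<open>cps_cot_app\<close> joins \<open>l\<close> with \<open>t\<close> under the binder of
  \<open>x\<close>.\<close>

lemma cps_beta1:
  "lam_red\<^sup>+\<^sup>+ (cps_cmd b T s (Cut (Lam t) (CTm u l)) G K)
     (cps_cmd b T s (Cut u (Sel (Cut t (lift_cot 0 l)))) G K)"
proof -
  let ?L = "cps_cot b T s l G K" and ?u = "cgps b T s u" and ?t = "cgps b T s t"
  let ?K = "LLam (LApp (LApp (LVar 0) (lift_lam 0 ?L)) (lift_lam 0 ?u))"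
    and ?N = "LLam (LLam (LApp (LVar 1) (lift_lam 1 ?t)))"
  have "lam_red\<^sup>+\<^sup>+ (cps_cmd b T s (Cut (Lam t) (CTm u l)) G K) (LApp ?K ?N)"
    using let_lam_red[of "LApp ?K ?N" G] by (simp add: tranclp.r_into_trancl)
  also have "lam_red\<^sup>*\<^sup>* (LApp ?K ?N) (LApp (LApp ?N ?L) ?u)"
    using lam_red.beta[of "LApp (LApp (LVar 0) (lift_lam 0 ?L)) (lift_lam 0 ?u)" ?N] by (simp add: r_into_rtranclp)
  also have "lam_red\<^sup>*\<^sup>* (LApp (LApp ?N ?L) ?u) (LApp (LLam (LApp (lift_lam 0 ?L) ?t)) ?u)"
    using lam_red.beta[of "LLam (LApp (LVar 1) (lift_lam 1 ?t))" ?L] by (intro r_into_rtranclp lam_red.LAppL) simp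
  also have "lam_red\<^sup>*\<^sup>* (LApp (LLam (LApp (lift_lam 0 ?L) ?t)) ?u)
      (cps_cmd b T s (Cut u (Sel (Cut t (lift_cot 0 l)))) G K)"
    by (simp add: reds_LAppL reds_LLam lift_cps[OF s] cps_cot_app[OF s])
  finally (tranclp_rtranclp_tranclp) show ?thesis .
qed

lemma cps_beta2:
  "lam_red\<^sup>+\<^sup>+ (cps_cmd b T s (Cut (TLam t) (CInh B l)) G K)
     (cps_cmd b T s (Cut (isubst_tm 0 B t) l) G K)"
proof -
  let ?L = "cps_cot b T s l G K" and ?t = "cgps (Suc b) (ilift_inh 0 T) s t" and ?B = "star_inh b T B"
  let ?K = "LLam (LApp (lift_lam 0 ?L) (LTApp (LVar 0) ?B))"
  have "lam_red\<^sup>+\<^sup>+ (cps_cmd b T s (Cut (TLam t) (CInh B l)) G K) (LApp ?K (LTLam ?t))"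
    using let_lam_red[of "LApp ?K (LTLam ?t)" G] by (simp add: tranclp.r_into_trancl)
  also have "lam_red\<^sup>*\<^sup>* (LApp ?K (LTLam ?t)) (LApp ?L (LTApp (LTLam ?t) ?B))"
    using lam_red.beta[of "LApp (lift_lam 0 ?L) (LTApp (LVar 0) ?B)" "LTLam ?t"] by (simp add: r_into_rtranclp)
  also have "lam_red\<^sup>*\<^sup>* (LApp ?L (LTApp (LTLam ?t) ?B)) (LApp ?L (cgps b T s (isubst_tm 0 B t)))"
    using lam_red.ibeta[of ?t ?B] by (intro r_into_rtranclp lam_red.LAppR) (simp add: isubst_cgps[OF s])
  also have "lam_red\<^sup>*\<^sup>* (LApp ?L (cgps b T s (isubst_tm 0 B t)))
      (cps_cmd b T s (Cut (isubst_tm 0 B t) l) G K)"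
    by (rule cps_cot_app[OF s])
  finally (tranclp_rtranclp_tranclp) show ?thesis .
qed

text \<open>Once \<open>E\<close> is absorbed into the continuation, the two sides differ only in
  \<open>G\<^sup>+\<close> against \<open>G\<close>.\<close>

lemma cps_pi:
  "ectx E \<Longrightarrow> lam_red\<^sup>+\<^sup>+ (cps_cmd b T s (Cut (Brc (Cut t l)) E) G K)
     (cps_cmd b T s (Cut t (append_cot l E)) G K)"
  by (simp add: cps_cmd_ectx cps_append_cot[OF s] cps_mono_G s_red)

lemma cps_sigma:
  "lam_red\<^sup>+\<^sup>+ (cps_cmd b T s (Cut t (Sel c)) G K) (cps_cmd b T s (subst_cmd 0 t c) G K)"
proof -
  have "lam_red\<^sup>+\<^sup>+ (cps_cmd b T s (Cut t (Sel c)) G K)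
      (subst_lam 0 (cgps b T s t) (cps_cmd b T s c (lift_lam 0 G) (lift_lam 0 K)))"
    by (simp add: lam_red.beta tranclp.r_into_trancl)
  also have "lam_red\<^sup>*\<^sup>* \<dots> (cps_cmd b T s (subst_cmd 0 t c) G K)"
    using subst_cps(3)[of 0 b T t c "lift_lam 0 G" "lift_lam 0 K"] by simp
  finally (tranclp_rtranclp_tranclp) show ?thesis .
qed

text \<open>If \<open>l\<close> is an evaluation context, both sides have the shape
  \<open>\<lambda>x. x H K'\<close>, with \<open>H\<close> being \<open>G\<^sup>+\<close> on the
  left and \<open>G\<close> on the right.\<close>

lemma cps_mu:
  "lam_red\<^sup>+\<^sup>+ (cps_cot b T s (Sel (Cut (Var 0) (lift_cot 0 l))) G K) (cps_cot b T s l G K)"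
  using ectx_or_Sel[of l]
proof
  assume l: "ectx l"
  show ?thesis
    by (simp add: cps_cmd_ectx[OF ectx_lift[OF l]] cps_cot_ectx[OF l] lift_cps_cont[OF s, symmetric]
        reds_LLam reds_LAppL reds_LAppR s_red)
next
  assume "\<exists>c. l = Sel c"
  then obtain c where l: "l = Sel c" ..
  show ?thesis
    \<comment> \<open>A variable cut against a selection is a \<open>\<sigma>\<close>-redex, whose
      contractum is \<open>c\<close> up to renaming.\<close>
    using cps_sigma[of b T "Var 0" "lift_cmd (Suc 0) c" "lift_lam 0 G" "lift_lam 0 K"]
    by (simp add: l reds_LLam subst_Var_lift_Suc_tm del: cps_cmd.simps)
qed

text \<open>This settles the root rules once for all four shapes of cut and leaves inner reductions
  as hypotheses.\<close>

lemma cps_cmd_red: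
  assumes "cmd_red (Cut t l) c'"
    and tm: "\<And>t' b T G K. tm_red t t' \<Longrightarrow> lam_red\<^sup>+\<^sup>+ (cps_cmd b T s (Cut t l) G K) (cps_cmd b T s (Cut t' l) G K)"
    and cot: "\<And>l' b T G K. cot_red l l' \<Longrightarrow> lam_red\<^sup>+\<^sup>+ (cps_cmd b T s (Cut t l) G K) (cps_cmd b T s (Cut t l') G K)"
  shows "lam_red\<^sup>+\<^sup>+ (cps_cmd b T s (Cut t l) G K) (cps_cmd b T s c' G K)"
  using assms(1)
proof cases
  case beta1
  then show ?thesis using cps_beta1 by blast
next
  case beta2
  then show ?thesis using cps_beta2 by blast
next
  case pi
  then show ?thesis using cps_pi by blast
next
  case sigma
  then show ?thesis using cps_sigma by blast
qed (use tm cot in blast)+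

text \<open>Co-term steps are also simulated under a cut with any \<open>t0\<close>: the translation
  of \<open>Cut t0 l\<close> inspects \<open>l\<close> and, unless \<open>l\<close> is a selection,
  does not contain the translation of \<open>l\<close>.\<close>

lemma cps_red:
  fixes t t' :: "'v tm" and l :: "'v cot" and c :: "'v cmd"
  shows "tm_red t t1 \<Longrightarrow> lam_red\<^sup>+\<^sup>+ (cps_tm b T s t G K) (cps_tm b T s t1 G K)"
    and "cot_red l l1 \<Longrightarrow> lam_red\<^sup>+\<^sup>+ (cps_cot b T s l G K) (cps_cot b T s l1 G K) \<and>
      lam_red\<^sup>+\<^sup>+ (cps_cmd b T s (Cut t0 l) G K) (cps_cmd b T s (Cut t0 l1) G K)"
    and "cmd_red c c1 \<Longrightarrow> lam_red\<^sup>+\<^sup>+ (cps_cmd b T s c G K) (cps_cmd b T s c1 G K)"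
    and cgps_red: "tm_red t' t1' \<Longrightarrow> lam_red\<^sup>+\<^sup>+ (cgps b T s t') (cgps b T s t1')"
proof (induction t and l and c and t'
    arbitrary: b T G K t1 and b T G K t0 l1 and b T G K c1 and b T t1' rule: cps_induct)
  case (Var i)
  then show ?case by cases
next
  case (Lam t)
  from Lam.prems show ?case
    by cases (simp add: Lam.IH reds_let_lam reds_LAppR reds_LLam reds_lift)
next
  case (TLam t)
  from TLam.prems show ?case
    by cases (simp add: TLam.IH reds_let_lam reds_LAppR reds_LTLam)
next
  case (Brc c)
  from Brc.prems show ?case
    \<comment> \<open>For an \<open>\<epsilon>\<close>-step the sides are
      \<open>(t : G\<^sup>+, K)\<close> and \<open>(t : G, K)\<close>.\<close>
    by cases (simp_all add: Brc.IH cps_mono_G s_red)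
next
  case CNil
  then show ?case by cases
next
  case (CTm u l)
  from CTm.prems show ?case
    by cases (simp_all add: CTm.IH cps_mono_K reds_LAppL reds_LAppR reds_LLam reds_lift)
next
  case (CInh B l)
  from CInh.prems show ?case
  proof cases
    case (CInhL B')
    then have "lam_red\<^sup>+\<^sup>+ (LTApp (LVar 0) (star_inh b T B)) (LTApp (LVar 0) (star_inh b T B'))"
      by (intro tranclp.r_into_trancl lam_red.LTAppR beta0_star)
    then show ?thesis
      using CInhL by (simp add: cps_mono_K reds_LAppR reds_LLam)
  qed (simp add: CInh.IH cps_mono_K reds_LAppL reds_LAppR reds_LLam reds_lift)
next
  case (Sel c)
  from Sel.prems show ?case
  proof cases
    case mu
    then show ?thesis
      \<comment> \<open>Under a cut with \<open>t0\<close>, the \<open>\<mu>\<close>-step has the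
        same result as a \<open>\<sigma>\<close>-step, since substituting \<open>t0\<close> for
        \<open>x\<close> in \<open>x l\<close> yields \<open>t0 l\<close>.\<close>
      using cps_mu cps_sigma[of b T t0 c G K] by simp
  qed (simp add: Sel.IH reds_LAppL reds_LLam)
next
  case (Cut_CNil t)
  show ?case
    by (rule cps_cmd_red[OF Cut_CNil.prems]) (auto simp: Cut_CNil.IH elim: cot_red.cases)
next
  case (Cut_CTm t u l)
  show ?case
    by (rule cps_cmd_red[OF Cut_CTm.prems]) (simp add: Cut_CTm.IH, rule Cut_CTm.IH(4)[THEN conjunct2])
next
  case (Cut_CInh t B l)
  show ?case
    by (rule cps_cmd_red[OF Cut_CInh.prems]) (simp add: Cut_CInh.IH, rule Cut_CInh.IH(3)[THEN conjunct2])
next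
  case (Cut_Sel t c)
  show ?case
    by (rule cps_cmd_red[OF Cut_Sel.prems])
      (simp add: Cut_Sel.IH reds_LAppR, rule Cut_Sel.IH(2)[THEN conjunct2])
next
  case (cgps t)
  show ?case
    unfolding cgps.simps
    by (intro reds_LLam cgps.IH source_red_lift cgps.prems)
qed

end

section \<open>Domain variables\<close>

lemma dvars_ilift_inh [simp]: "dvars_inh (ilift_inh k A) = dvars_inh A"
  by (induction A arbitrary: k) auto

lemma dvars_isubst_inh: "dvars_inh (isubst_inh k C A) \<subseteq> dvars_inh C \<union> dvars_inh A"
proof (induction A arbitrary: k C)
  case (ILam A)
  from this[of "Suc k" "ilift_inh 0 C"] show ?case by simp
next
  case (All D A)
  from this[of "Suc k" "ilift_inh 0 C"] show ?case by auto
qed (simp; blast)+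

lemma dvars_beta0: "beta0 A B \<Longrightarrow> dvars_inh B \<subseteq> dvars_inh A"
proof (induction rule: beta0.induct)
  case (beta0 A B)
  then show ?case using dvars_isubst_inh[of 0 B A] by auto
qed auto

lemma dvars_lift_lam [simp]: "dvars_lam (lift_lam k t) = dvars_lam t"
  by (induction t arbitrary: k) auto

lemma dvars_ilift_lam [simp]: "dvars_lam (ilift_lam k t) = dvars_lam t"
  by (induction t arbitrary: k) auto

lemma dvars_subst_lam: "dvars_lam (subst_lam k v t) \<subseteq> dvars_lam v \<union> dvars_lam t"
proof (induction t arbitrary: k v)
  case (LLam t)
  from this[of "Suc k" "lift_lam 0 v"] show ?case by simp
next
  case (LTLam t)
  from this[of k "ilift_lam 0 v"] show ?case by simp
qed (simp; blast)+

lemma dvars_isubst_lam: "dvars_lam (isubst_lam k C t) \<subseteq> dvars_inh C \<union> dvars_lam t"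
proof (induction t arbitrary: k C)
  case (LTLam t)
  from this[of "Suc k" "ilift_inh 0 C"] show ?case by simp
next
  case (LTApp t B)
  then show ?case using dvars_isubst_inh[of k C B] by (simp; blast)
qed (simp; blast)+

lemma dvars_lam_red: "lam_red t u \<Longrightarrow> dvars_lam u \<subseteq> dvars_lam t"
proof (induction rule: lam_red.induct)
  case (beta t u)
  then show ?case using dvars_subst_lam[of 0 u t] by auto
next
  case (ibeta t B)
  then show ?case using dvars_isubst_lam[of 0 B t] by auto
next
  case (LTAppR B B' t)
  then show ?case using dvars_beta0 by fastforce
qed auto

text \<open>Since no step creates domain variables, all later terms stay in the subsystem once the
  first one lies in it.\<close>

lemma lam_red_omega_tranclp:
  assumes "lam_red\<^sup>+\<^sup>+ t u" "omega_lam t"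
  shows "lam_red_omega\<^sup>+\<^sup>+ t u"
proof -
  have "lam_red_omega\<^sup>+\<^sup>+ t u \<and> omega_lam u"
    using assms
  proof (induction rule: tranclp_induct)
    case (base u)
    then show ?case
      using dvars_lam_red[of t u] by (auto simp: omega_lam_def lam_red_omega_def)
  next
    case (step u v)
    then have "lam_red_omega u v \<and> omega_lam v"
      using dvars_lam_red[of u v] by (auto simp: omega_lam_def lam_red_omega_def)
    with step show ?case by (auto intro: tranclp.trancl_into_trancl)
  qed
  then show ?thesis ..
qed

lemma dvars_lift_tm [simp]:
  fixes t :: "'v tm" and l :: "'v cot" and c :: "'v cmd"
  shows "dvars_tm (lift_tm k t) = dvars_tm t"
    and "dvars_cot (lift_cot k l) = dvars_cot l"
    and "dvars_cmd (lift_cmd k c) = dvars_cmd c"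
  by (induction t and l and c arbitrary: k and k and k) auto

lemma dvars_star: "dvars_inh (star_inh b T A) \<subseteq> dvars_inh T \<union> dvars_inh A"
proof (induction A arbitrary: b T)
  case (ILam A)
  from this[of "Suc b" "ilift_inh 0 T"] show ?case by simp
next
  case (All D A)
  from this[of "Suc b" "ilift_inh 0 T"] show ?case by (auto simp: neg_inh_def)
qed (fastforce simp: neg_inh_def)+

text \<open>Supplies the starting term for \<open>lam_red_omega_tranclp\<close>.\<close>

lemma omega_cps:
  fixes t t' :: "'v tm" and l :: "'v cot" and c :: "'v cmd"
  assumes s: "omega_lam s"
  shows "dvars_inh T = {} \<Longrightarrow> dvars_tm t = {} \<Longrightarrow> dvars_lam G = {} \<Longrightarrow> dvars_lam K = {} \<Longrightarrow>
      dvars_lam (cps_tm b T s t G K) = {}"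
    and "dvars_inh T = {} \<Longrightarrow> dvars_cot l = {} \<Longrightarrow> dvars_lam G = {} \<Longrightarrow> dvars_lam K = {} \<Longrightarrow>
      dvars_lam (cps_cot b T s l G K) = {}"
    and "dvars_inh T = {} \<Longrightarrow> dvars_cmd c = {} \<Longrightarrow> dvars_lam G = {} \<Longrightarrow> dvars_lam K = {} \<Longrightarrow>
      dvars_lam (cps_cmd b T s c G K) = {}"
    and omega_cgps: "dvars_inh T = {} \<Longrightarrow> dvars_tm t' = {} \<Longrightarrow> dvars_lam (cgps b T s t') = {}"
proof (induction t and l and c and t' arbitrary: b T G K and b T G K and b T G K and b T
    rule: cps_induct)
  case (CInh B l)
  then show ?case using dvars_star[of b T B] by simp
next
  case (Cut_CInh t B l)
  then show ?case using dvars_star[of b T B] by simp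
qed (use s in \<open>simp_all add: let_lam_def omega_lam_def cgps.simps\<close>)

theorem theorem5p7:
  fixes b :: nat and T :: "'v inh" and s :: "'v lam"
  assumes s_closed: "closed_lam s"
  shows "((\<forall>G. lam_red\<^sup>+\<^sup>+ (LApp s G) G) \<longrightarrow>
            (\<forall>t u. tm_red t u \<longrightarrow> lam_red\<^sup>+\<^sup>+ (cgps b T s t) (cgps b T s u))) \<and>
         (omega_inh T \<and> omega_lam s \<and>
          (\<forall>G. omega_lam G \<longrightarrow> lam_red_omega\<^sup>+\<^sup>+ (LApp s G) G) \<longrightarrow>
            (\<forall>t u. tm_red_omega t u \<longrightarrow> lam_red_omega\<^sup>+\<^sup>+ (cgps b T s t) (cgps b T s u)))"
proof (intro conjI impI allI)
  fix t u :: "'v tm"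
  assume "\<forall>G. lam_red\<^sup>+\<^sup>+ (LApp s G) G" and "tm_red t u"
  then show "lam_red\<^sup>+\<^sup>+ (cgps b T s t) (cgps b T s u)"
    using s_closed cgps_reduction.cgps_red[of s] by (simp add: cgps_reduction_def)
next
  fix t u :: "'v tm"
  assume *: "omega_inh T \<and> omega_lam s \<and>
      (\<forall>G. omega_lam G \<longrightarrow> lam_red_omega\<^sup>+\<^sup>+ (LApp s G) G)"
    and red: "tm_red_omega t u"
  have "lam_red_omega\<^sup>+\<^sup>+ (LApp s (LVar 0)) (LVar 0)"
    using * by (simp add: omega_lam_def)
  then have x: "lam_red\<^sup>+\<^sup>+ (LApp s (LVar 0)) (LVar 0)"
    by (rule tranclp_map[of lam_red_omega lam_red "\<lambda>t. t", rotated]) (simp add: lam_red_omega_def)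
  txt \<open>\<open>s\<close> is only known to act as an identity on terms without domain variables; by closedness,
    its action on a variable determines its action on every term.\<close>
  have "lam_red\<^sup>+\<^sup>+ (LApp s G) G" for G
    using tranclp_map[of lam_red lam_red "subst_lam 0 G", OF lam_red_subst x]
    by (simp add: closed_lam_invariant[OF s_closed])
  then have "lam_red\<^sup>+\<^sup>+ (cgps b T s t) (cgps b T s u)"
    using s_closed red cgps_reduction.cgps_red[of s]
    by (simp add: cgps_reduction_def tm_red_omega_def)
  then show "lam_red_omega\<^sup>+\<^sup>+ (cgps b T s t) (cgps b T s u)"
    using * red
    by (intro lam_red_omega_tranclp)
      (simp_all add: omega_lam_def omega_inh_def omega_tm_def tm_red_omega_def omega_cgps)
qed

end
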